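(* Let $\psi(z)=\sum_{k=0}^{\infty}\beta_kz^k$ be holomorphic in the open unit disk $\mathbb{D}$ with $\beta_0\neq0$. Let $F\in\mathcal{A}_{\mathrm{Id},\psi}$ and let $G=F^{-1}\in\mathcal{B}_{\mathrm{Id},\psi}$. Then for every $\lambda\in\mathbb{C}$ we have $$|\Phi_2(G,\lambda)|\leq\left|\frac{\beta_1^2}{\beta_0^8}\right|\cdot\max\left\{C,D,E\right\},$$ where $$C=\max(1,|\lambda|),\qquad D=\left|\frac{\Phi_1(\psi,\lambda)}{\beta_1^2}+(4\lambda-5)\frac{\Phi_0(\psi)}{\beta_0^2}\right|,$$ $$E=\frac{1}{2}|4\lambda-5|\left|\frac{\beta_1}{\beta_0}\right|+|1-\lambda|\left|\frac{\beta_2}{\beta_1}\right|+\frac{C}{2}.$$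
   Context: $\mathcal{A}_{\mathrm{Id},\psi}$ is the class of functions $F$ holomorphic in $\mathbb{D}$ of the form $F(z)=z\psi(\omega(z))$, $z\in\mathbb{D}$, for some holomorphic self-mapping $\omega$ of $\mathbb{D}$ with $\omega(0)=0$. Since $F(0)=0$ and $F'(0)=\beta_0\neq0$, $F$ has a local inverse $F^{-1}$ near zero with $F^{-1}(0)=0$, and $\mathcal{B}_{\mathrm{Id},\psi}:=\{F^{-1}:F\in\mathcal{A}_{\mathrm{Id},\psi}\}$. For $f(z)=\sum_{k=0}^\infty f_kz^k$ holomorphic near zero, $\lambda\in\mathbb{C}$ and $n=0,1,2,\ldots$, $\Phi_n(f,\lambda):=f_nf_{n+2}-\lambda f_{n+1}^2$ and $\Phi_n(f):=\Phi_n(f,1)$; thus $\Phi_1(\psi,\lambda)=\beta_1\beta_3-\lambda\beta_2^2$ and $\Phi_0(\psi)=\beta_0\beta_2-\beta_1^2$.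
   Formalization: The formal theorem additionally assumes β₁ ≠ 0, because the stated bound divides by β₁ (in β₂/β₁ and Φ₁(ψ,λ)/β₁²) and is undefined when β₁ = 0. *)

theory Defs
  imports "HOL-Complex_Analysis.Complex_Analysis"
begin

definition class_A_Id :: "(complex \<Rightarrow> complex) \<Rightarrow> (complex \<Rightarrow> complex) set" where
  "class_A_Id \<psi> = {F. F holomorphic_on ball 0 1 \<and>
     (\<exists>\<omega>. \<omega> holomorphic_on ball 0 1 \<and> \<omega> ` ball 0 1 \<subseteq> ball 0 1 \<and> \<omega> 0 = 0 \<and>
       (\<forall>z\<in>ball 0 1. F z = z * \<psi> (\<omega> z)))}"

(* A function stands for its germ at 0: only the values of F and G near 0 matter,
   so F determines its local inverse only up to equality near 0. *)
definition local_inverse_at_0 :: "(complex \<Rightarrow> complex) \<Rightarrow> (complex \<Rightarrow> complex) \<Rightarrow> bool" where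
  "local_inverse_at_0 F G \<longleftrightarrow> G analytic_on {0} \<and> G 0 = 0 \<and>
     (\<forall>\<^sub>F z in nhds 0. G (F z) = z) \<and> (\<forall>\<^sub>F w in nhds 0. F (G w) = w)"

definition class_B_Id :: "(complex \<Rightarrow> complex) \<Rightarrow> (complex \<Rightarrow> complex) set" where
  "class_B_Id \<psi> = {G. \<exists>F\<in>class_A_Id \<psi>. local_inverse_at_0 F G}"

definition Phi :: "nat \<Rightarrow> (complex \<Rightarrow> complex) \<Rightarrow> complex \<Rightarrow> complex" where
  "Phi n f \<mu> =
     fps_nth (fps_expansion f 0) n * fps_nth (fps_expansion f 0) (n + 2)
     - \<mu> * fps_nth (fps_expansion f 0) (n + 1) ^ 2"

abbreviation Phi1 :: "nat \<Rightarrow> (complex \<Rightarrow> complex) \<Rightarrow> complex" where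
  "Phi1 n f \<equiv> Phi n f 1"

end

theory Submission
  imports Defs
begin

text \<open>The proof compares the leading coefficients of \<open>F\<close>, \<open>G\<close>, \<open>\<psi>\<close> and \<open>\<omega>\<close>. By the Schwarz
  lemma \<open>\<omega> z = z * \<phi> z\<close> with \<open>\<phi>\<close> holomorphic and bounded by 1 in the disk; let \<open>q\<^sub>0, q\<^sub>1, q\<^sub>2\<close>
  be the first coefficients of \<open>\<phi>\<close>. Inverting \<open>F z = z * \<psi> (z * \<phi> z)\<close> as a power series, one
  finds that \<open>Phi 2 G \<mu>\<close> equals \<open>\<beta>\<^sub>1\<^sup>2 / \<beta>\<^sub>0\<^sup>8\<close> times
  \<open>q\<^sub>0 q\<^sub>2 - \<mu> q\<^sub>1\<^sup>2 + 2 K q\<^sub>0\<^sup>2 q\<^sub>1 + L q\<^sub>0\<^sup>4\<close>, where \<open>\<bar>L\<bar> = D\<close> and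
  \<open>\<bar>K\<bar> \<le> E - C / 2\<close>.

  Put \<open>s = \<bar>q\<^sub>0\<bar>\<^sup>2\<close>. The Schur algorithm yields the sharp coefficient inequalities
  \<open>\<bar>q\<^sub>1\<bar> \<le> 1 - s\<close> and \<open>\<bar>q\<^sub>0 q\<^sub>2\<bar> + \<bar>q\<^sub>1\<bar>\<^sup>2 \<le> 1 - s\<close>
  (\<open>schur_coeff_1_bound\<close>, \<open>schur_coeff_2_bound\<close>). The expression is therefore at most
  \<open>C (1 - s) + 2 \<bar>K\<bar> s (1 - s) + D s\<^sup>2\<close>. Splitting \<open>1 - s = (1 - s)\<^sup>2 + s (1 - s)\<close> in the first
  term turns this into at most \<open>(1 - s)\<^sup>2 C + 2 s (1 - s) E + s\<^sup>2 D\<close>, a convex combination of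
  \<open>C\<close>, \<open>E\<close>, \<open>D\<close>; it cannot exceed their maximum.\<close>

section \<open>Coefficients of functions bounded by 1 in the disk\<close>

text \<open>Taylor series of functions in the Schur class. The bound is non-strict so that unimodular
  constants belong to the class and every step of the Schur algorithm stays inside it.\<close>

definition schur_fps :: "complex fps \<Rightarrow> bool" where
  "schur_fps P \<longleftrightarrow> (\<exists>\<phi>. \<phi> holomorphic_on ball 0 1 \<and>
     (\<forall>z\<in>ball 0 1. norm (\<phi> z) \<le> 1) \<and> \<phi> has_fps_expansion P)"

lemma schur_fps_nth_0_le:
  assumes "schur_fps P"
  shows "norm (fps_nth P 0) \<le> 1"
proof -
  obtain \<phi> where "\<forall>z\<in>ball 0 1. norm (\<phi> z) \<le> 1" "\<phi> has_fps_expansion P"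
    using assms by (auto simp: schur_fps_def)
  then show ?thesis
    by (metis centre_in_ball has_fps_expansion_imp_0_eq_fps_nth_0 zero_less_one)
qed

text \<open>The Schwarz lemma as a division: the quotient extends over 0 and inherits the bound, at 0
  from the derivative part of the Schwarz lemma and elsewhere from the growth part.\<close>

lemma schwarz_divide:
  assumes "f holomorphic_on ball 0 1" "f 0 = 0" "\<And>z. norm z < 1 \<Longrightarrow> norm (f z) < 1"
  obtains h where "h holomorphic_on ball 0 1" "\<And>z. norm z < 1 \<Longrightarrow> f z = z * h z"
    "\<And>z. norm z < 1 \<Longrightarrow> norm (h z) \<le> 1"
proof -
  obtain h where h: "h holomorphic_on ball 0 1" "\<And>z. norm z < 1 \<Longrightarrow> f z = z * h z"
    "deriv f 0 = h 0"
    using Schwarz3[OF assms(1,2)] by blast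
  have "norm (h z) \<le> 1" if z: "norm z < 1" for z
  proof (cases "z = 0")
    case True
    then show ?thesis
      using Schwarz_Lemma(2)[OF assms z] h(3) by simp
  next
    case False
    then show ?thesis
      using Schwarz_Lemma(1)[OF assms z] h(2)[OF z] by (simp add: norm_mult)
  qed
  with h that show thesis by blast
qed

lemma bounded_by_1_imp_constant_or_less:
  assumes "\<phi> holomorphic_on ball 0 1" "\<And>z. norm z < 1 \<Longrightarrow> norm (\<phi> z) \<le> 1"
  shows "(\<forall>z\<in>ball 0 1. \<phi> z = \<phi> 0) \<or> (\<forall>z\<in>ball 0 1. norm (\<phi> z) < 1)"
proof (rule disjCI)
  assume "\<not> (\<forall>z\<in>ball 0 1. norm (\<phi> z) < 1)"
  then obtain \<xi> where \<xi>: "\<xi> \<in> ball 0 1" "norm (\<phi> \<xi>) \<ge> 1"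
    by (auto simp: not_less)
  have "\<phi> constant_on ball 0 1"
    by (rule maximum_modulus_principle[OF assms(1) _ _ _ order_refl \<xi>(1)])
       (use assms(2) \<xi> in \<open>auto intro: order_trans\<close>)
  then show "\<forall>z\<in>ball 0 1. \<phi> z = \<phi> 0"
    by (auto simp: constant_on_def)
qed

text \<open>One step of the Schur algorithm: apply the disk automorphism that sends \<open>P\<^sub>0\<close> to 0, then
  divide by \<open>z\<close>. The identity is written without a quotient, which keeps it meaningful when \<open>P\<close>
  is a unimodular constant and the automorphism degenerates; there \<open>Q = 0\<close> works.\<close>

lemma schur_step:
  assumes "schur_fps P"
  obtains Q where "schur_fps Q"
    "P - fps_const (fps_nth P 0) = fps_X * Q * (1 - fps_const (cnj (fps_nth P 0)) * P)"
proof -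
  obtain \<phi> where \<phi>: "\<phi> holomorphic_on ball 0 1" "\<And>z. norm z < 1 \<Longrightarrow> norm (\<phi> z) \<le> 1"
    "\<phi> has_fps_expansion P"
    using assms by (auto simp: schur_fps_def)
  define c where "c = fps_nth P 0"
  have c: "\<phi> 0 = c"
    using has_fps_expansion_imp_0_eq_fps_nth_0[OF \<phi>(3)] by (simp add: c_def)
  have "\<exists>h. h holomorphic_on ball 0 1 \<and> (\<forall>z\<in>ball 0 1. norm (h z) \<le> 1) \<and>
            (\<forall>z\<in>ball 0 1. \<phi> z - c = z * h z * (1 - cnj c * \<phi> z))"
    using bounded_by_1_imp_constant_or_less[OF \<phi>(1,2)]
  proof
    assume "\<forall>z\<in>ball 0 1. \<phi> z = \<phi> 0"
    then show ?thesis
      by (intro exI[of _ "\<lambda>_. 0"]) (auto simp: c)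
  next
    assume less: "\<forall>z\<in>ball 0 1. norm (\<phi> z) < 1"
    then have cless: "norm c < 1" using c by auto
    define f where "f = (\<lambda>z. Moebius_function 0 c (\<phi> z))"
    have "Moebius_function 0 c \<circ> \<phi> holomorphic_on ball 0 1"
      by (rule holomorphic_on_compose_gen[OF \<phi>(1) Moebius_function_holomorphic[OF cless]])
         (use less in auto)
    then have f: "f holomorphic_on ball 0 1" by (simp add: f_def o_def)
    have f0: "f 0 = 0" by (simp add: f_def c Moebius_function_eq_zero)
    have fless: "norm (f z) < 1" if "norm z < 1" for z
      using that less cless by (auto simp: f_def intro: Moebius_function_norm_lt_1)
    obtain h where h: "h holomorphic_on ball 0 1"
      "\<And>z. norm z < 1 \<Longrightarrow> f z = z * h z" "\<And>z. norm z < 1 \<Longrightarrow> norm (h z) \<le> 1"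
      using schwarz_divide[OF f f0 fless] by blast
    have "\<phi> z - c = z * h z * (1 - cnj c * \<phi> z)" if "norm z < 1" for z
    proof -
      have "norm (cnj c * \<phi> z) < 1 * 1"
        using cless less that by (intro norm_mult_less) auto
      then have "1 - cnj c * \<phi> z \<noteq> 0" by auto
      then show ?thesis
        using h(2)[OF that, symmetric] by (simp add: f_def Moebius_function_simple)
    qed
    with h show ?thesis by auto
  qed
  then obtain h where h: "h holomorphic_on ball 0 1" "\<forall>z\<in>ball 0 1. norm (h z) \<le> 1"
    "\<forall>z\<in>ball 0 1. \<phi> z - c = z * h z * (1 - cnj c * \<phi> z)" by blast
  define Q where "Q = fps_expansion h 0"
  have Q: "h has_fps_expansion Q"
    unfolding Q_def by (rule has_fps_expansion_fps_expansion[OF _ _ h(1)]) auto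
  have lhs: "(\<lambda>z. \<phi> z - c) has_fps_expansion P - fps_const c"
    by (intro fps_expansion_intros \<phi>(3))
  have rhs: "(\<lambda>z. z * h z * (1 - cnj c * \<phi> z)) has_fps_expansion
      fps_X * Q * (1 - fps_const (cnj c) * P)"
    by (intro fps_expansion_intros \<phi>(3) Q)
  have "eventually (\<lambda>z. \<phi> z - c = z * h z * (1 - cnj c * \<phi> z)) (nhds 0)"
    by (rule eventually_nhds_in_open[of "ball 0 1", THEN eventually_mono]) (use h(3) in auto)
  from has_fps_expansion_cong[OF this refl] rhs
  have "(\<lambda>z. \<phi> z - c) has_fps_expansion fps_X * Q * (1 - fps_const (cnj c) * P)"
    by simp
  with lhs have "P - fps_const c = fps_X * Q * (1 - fps_const (cnj c) * P)"
    by (rule fps_expansion_unique_complex)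
  then show thesis
    using that[of Q] h Q by (auto simp: schur_fps_def c_def)
qed

lemma schur_coeff_recursion:
  assumes "schur_fps P"
  obtains Q where "schur_fps Q"
    "fps_nth P 1 = fps_nth Q 0 * (1 - (norm (fps_nth P 0))\<^sup>2)"
    "fps_nth P 2 = fps_nth Q 1 * (1 - (norm (fps_nth P 0))\<^sup>2)
                   - cnj (fps_nth P 0) * fps_nth Q 0 * fps_nth P 1"
proof -
  obtain Q where Q: "schur_fps Q"
    "P - fps_const (fps_nth P 0) = fps_X * (Q * (1 - fps_const (cnj (fps_nth P 0)) * P))"
    using schur_step[OF assms] unfolding mult.assoc by blast
  have sq: "(complex_of_real (norm (fps_nth P 0)))\<^sup>2 = fps_nth P 0 * cnj (fps_nth P 0)"
    using complex_norm_square[of "fps_nth P 0"] by simp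
  have "fps_nth (P - fps_const (fps_nth P 0)) 1 =
      fps_nth (fps_X * (Q * (1 - fps_const (cnj (fps_nth P 0)) * P))) 1"
    using Q(2) by simp
  then have 1: "fps_nth P 1 = fps_nth Q 0 * (1 - (norm (fps_nth P 0))\<^sup>2)"
    using sq by (simp add: fps_mult_nth_1 algebra_simps)
  have "fps_nth (P - fps_const (fps_nth P 0)) 2 =
      fps_nth (fps_X * (Q * (1 - fps_const (cnj (fps_nth P 0)) * P))) 2"
    using Q(2) by simp
  then have 2: "fps_nth P 2 = fps_nth Q 1 * (1 - (norm (fps_nth P 0))\<^sup>2)
                   - cnj (fps_nth P 0) * fps_nth Q 0 * fps_nth P 1"
    using sq by (simp add: fps_mult_nth_1 numeral_2_eq_2 algebra_simps)
  from Q(1) 1 2 show thesis using that[of Q] by blast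
qed

lemma norm_one_minus_norm_sq:
  fixes c :: complex
  assumes "norm c \<le> 1"
  shows "norm (1 - (complex_of_real (norm c))\<^sup>2) = 1 - (norm c)\<^sup>2"
proof -
  have "1 - (complex_of_real (norm c))\<^sup>2 = of_real (1 - (norm c)\<^sup>2)"
    by simp
  moreover have "0 \<le> 1 - (norm c)\<^sup>2"
    using assms by (simp add: abs_square_le_1)
  ultimately show ?thesis
    by (simp only: norm_of_real abs_of_nonneg)
qed

text \<open>This is the Schwarz-Pick inequality at 0.\<close>

lemma schur_coeff_1_bound:
  assumes "schur_fps P"
  shows "norm (fps_nth P 1) \<le> 1 - (norm (fps_nth P 0))\<^sup>2"
proof -
  obtain Q where Q: "schur_fps Q" "fps_nth P 1 = fps_nth Q 0 * (1 - (norm (fps_nth P 0))\<^sup>2)"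
    using schur_coeff_recursion[OF assms] by metis
  have c: "norm (fps_nth P 0) \<le> 1" "(norm (fps_nth P 0))\<^sup>2 \<le> 1"
    using schur_fps_nth_0_le[OF assms] by (auto simp: abs_square_le_1)
  have "norm (fps_nth P 1) = norm (fps_nth Q 0) * (1 - (norm (fps_nth P 0))\<^sup>2)"
    unfolding Q(2) by (simp add: norm_mult norm_one_minus_norm_sq c)
  also have "\<dots> \<le> 1 * (1 - (norm (fps_nth P 0))\<^sup>2)"
    by (intro mult_right_mono schur_fps_nth_0_le Q) (use c in auto)
  finally show ?thesis by simp
qed

text \<open>With \<open>x = \<bar>P\<^sub>0\<bar>\<close> and \<open>y = \<bar>Q\<^sub>0\<bar>\<close> for the Schur successor \<open>Q\<close>, the Schwarz-Pick inequality
  for \<open>Q\<close> bounds \<open>\<bar>P\<^sub>2\<bar>\<close>, and the left-hand side becomes at most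
  \<open>(1 - x\<^sup>2) * (1 - (1 - x) * (1 - y\<^sup>2))\<close>.\<close>

lemma schur_coeff_2_bound:
  assumes "schur_fps P"
  shows "norm (fps_nth P 0) * norm (fps_nth P 2) + (norm (fps_nth P 1))\<^sup>2
           \<le> 1 - (norm (fps_nth P 0))\<^sup>2"
proof -
  obtain Q where Q: "schur_fps Q"
    "fps_nth P 1 = fps_nth Q 0 * (1 - (norm (fps_nth P 0))\<^sup>2)"
    "fps_nth P 2 = fps_nth Q 1 * (1 - (norm (fps_nth P 0))\<^sup>2)
                   - cnj (fps_nth P 0) * fps_nth Q 0 * fps_nth P 1"
    using schur_coeff_recursion[OF assms] by metis
  define x y where "x = norm (fps_nth P 0)" and "y = norm (fps_nth Q 0)"
  have x: "0 \<le> x" "x \<le> 1" "x\<^sup>2 \<le> 1" and y: "0 \<le> y" "y \<le> 1" "y\<^sup>2 \<le> 1"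
    using schur_fps_nth_0_le[OF assms] schur_fps_nth_0_le[OF Q(1)]
    by (auto simp: abs_square_le_1 x_def y_def)
  have p1: "norm (fps_nth P 1) = y * (1 - x\<^sup>2)"
    unfolding Q(2) using x by (simp add: norm_mult norm_one_minus_norm_sq x_def y_def)
  have "norm (fps_nth P 2) \<le> norm (fps_nth Q 1) * (1 - x\<^sup>2) + x * y * norm (fps_nth P 1)"
    unfolding Q(3) using x
    by (intro norm_triangle_ineq4[THEN order_trans])
       (simp add: norm_mult norm_one_minus_norm_sq x_def y_def)
  also have "\<dots> \<le> (1 - y\<^sup>2) * (1 - x\<^sup>2) + x * y * norm (fps_nth P 1)"
    by (intro add_mono mult_right_mono order_refl)
       (use schur_coeff_1_bound[OF Q(1)] x in \<open>auto simp: y_def\<close>)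
  finally have "norm (fps_nth P 2) \<le> (1 - x\<^sup>2) * (1 - y\<^sup>2 + x * y\<^sup>2)"
    unfolding p1 by (simp add: algebra_simps power2_eq_square)
  then have "x * norm (fps_nth P 2) + (norm (fps_nth P 1))\<^sup>2
      \<le> x * ((1 - x\<^sup>2) * (1 - y\<^sup>2 + x * y\<^sup>2)) + (y * (1 - x\<^sup>2))\<^sup>2"
    unfolding p1 by (intro add_right_mono mult_left_mono x)
  also have "\<dots> = (1 - x\<^sup>2) * (1 - (1 - x) * (1 - y\<^sup>2))"
    by (simp add: algebra_simps power2_eq_square)
  also have "\<dots> \<le> (1 - x\<^sup>2) * 1"
    using x y by (intro mult_left_mono) auto
  finally show ?thesis by (simp add: x_def)
qed

section \<open>Coefficients of compositional inverses\<close>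

text \<open>Since the i-th power of \<open>fps_X * V\<close> is \<open>fps_X ^ i * V ^ i\<close>, only the coefficients of
  \<open>V ^ i\<close> up to index \<open>n - i\<close> enter the n-th coefficient of the composition. These formulas
  serve twice: for \<open>\<psi>\<close> composed with \<open>\<omega>\<close>, and for an inverse series composed with the series
  that it inverts.\<close>

lemma compose_X_mult_nth:
  fixes P V :: "'a::comm_ring_1 fps"
  shows "fps_nth (P oo (fps_X * V)) 0 = fps_nth P 0"
    and "fps_nth (P oo (fps_X * V)) 1 = fps_nth P 1 * fps_nth V 0"
    and "fps_nth (P oo (fps_X * V)) 2 = fps_nth P 1 * fps_nth V 1 + fps_nth P 2 * fps_nth V 0 ^ 2"
    and "fps_nth (P oo (fps_X * V)) 3 = fps_nth P 1 * fps_nth V 2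
       + 2 * fps_nth P 2 * fps_nth V 0 * fps_nth V 1 + fps_nth P 3 * fps_nth V 0 ^ 3"
    and "fps_nth (P oo (fps_X * V)) 4 = fps_nth P 1 * fps_nth V 3
       + fps_nth P 2 * (fps_nth V 1 ^ 2 + 2 * fps_nth V 0 * fps_nth V 2)
       + 3 * fps_nth P 3 * fps_nth V 0 ^ 2 * fps_nth V 1 + fps_nth P 4 * fps_nth V 0 ^ 4"
proof -
  have c: "fps_nth (P oo (fps_X * V)) n = (\<Sum>i=0..n. fps_nth P i * fps_nth (V ^ i) (n - i))" for n
    by (auto simp: fps_compose_nth power_mult_distrib fps_X_power_mult_nth intro!: sum.cong)
  have s: "{0..1} = {0,1::nat}" "{0..2} = {0,1,2::nat}" "{0..3} = {0,1,2,3::nat}" "{0..4} = {0,1,2,3,4::nat}"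
    by auto
  have p: "fps_nth (V ^ 2) 1 = 2 * fps_nth V 0 * fps_nth V 1"
    "fps_nth (V ^ 2) 2 = fps_nth V 1 ^ 2 + 2 * fps_nth V 0 * fps_nth V 2"
    by (simp_all add: power2_eq_square fps_mult_nth s algebra_simps)
  have p3: "fps_nth (V ^ 3) 1 = 3 * fps_nth V 0 ^ 2 * fps_nth V 1"
    by (simp add: power3_eq_cube power2_eq_square fps_mult_nth s algebra_simps)
  show "fps_nth (P oo (fps_X * V)) 0 = fps_nth P 0"
    by (simp add: c)
  show "fps_nth (P oo (fps_X * V)) 1 = fps_nth P 1 * fps_nth V 0"
    unfolding c s by simp
  show "fps_nth (P oo (fps_X * V)) 2 = fps_nth P 1 * fps_nth V 1 + fps_nth P 2 * fps_nth V 0 ^ 2"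
    unfolding c s by (simp add: fps_power_zeroth)
  show "fps_nth (P oo (fps_X * V)) 3 = fps_nth P 1 * fps_nth V 2
       + 2 * fps_nth P 2 * fps_nth V 0 * fps_nth V 1 + fps_nth P 3 * fps_nth V 0 ^ 3"
    unfolding c s by (simp add: p[simplified] fps_power_zeroth mult.left_commute mult.assoc mult.commute)
  show "fps_nth (P oo (fps_X * V)) 4 = fps_nth P 1 * fps_nth V 3
       + fps_nth P 2 * (fps_nth V 1 ^ 2 + 2 * fps_nth V 0 * fps_nth V 2)
       + 3 * fps_nth P 3 * fps_nth V 0 ^ 2 * fps_nth V 1 + fps_nth P 4 * fps_nth V 0 ^ 4"
    unfolding c s by (simp add: p[simplified] p3[simplified] fps_power_zeroth mult.left_commute mult.assoc mult.commute)
qed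

text \<open>Comparing coefficients in \<open>B oo (fps_X * V) = fps_X\<close> gives a triangular system for the
  coefficients of \<open>B\<close>. The denominators of its solutions are powers of \<open>V\<^sub>0\<close>, namely
  \<open>V\<^sub>0\<^sup>3\<close>, \<open>V\<^sub>0\<^sup>5\<close> and \<open>V\<^sub>0\<^sup>7\<close>, so both products in the functional have the
  common denominator \<open>V\<^sub>0 ^ 10\<close>.\<close>

lemma inverse_series_phi_2:
  fixes B V :: "complex fps"
  assumes inv: "B oo (fps_X * V) = fps_X" and V0: "fps_nth V 0 \<noteq> 0"
  shows "fps_nth B 2 * fps_nth B 4 - \<mu> * fps_nth B 3 ^ 2 =
    (fps_nth V 0 ^ 2 * (fps_nth V 1 * fps_nth V 3 - \<mu> * fps_nth V 2 ^ 2)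
     + (4 * \<mu> - 5) * (fps_nth V 0 * fps_nth V 1 ^ 2 * fps_nth V 2 - fps_nth V 1 ^ 4))
    / fps_nth V 0 ^ 10"
proof -
  define v where "v = fps_nth V"
  define b where "b = fps_nth B"
  note c = compose_X_mult_nth[of B V, unfolded inv, folded v_def b_def]
  have v0: "v 0 \<noteq> 0" using V0 by (simp add: v_def)
  have e1: "b 1 * v 0 = 1"
    using c(2) by simp
  have e2: "b 1 * v 1 + b 2 * v 0 ^ 2 = 0"
    using c(3) by simp
  have e3: "b 1 * v 2 + 2 * b 2 * v 0 * v 1 + b 3 * v 0 ^ 3 = 0"
    using c(4) by simp
  have e4: "b 1 * v 3 + b 2 * (v 1 ^ 2 + 2 * v 0 * v 2) + 3 * b 3 * v 0 ^ 2 * v 1 + b 4 * v 0 ^ 4 = 0"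
    using c(5) by simp
  have b2: "b 2 * v 0 ^ 3 = - v 1"
    using e1 e2 by algebra
  have b3: "b 3 * v 0 ^ 5 = 2 * v 1 ^ 2 - v 0 * v 2"
    using e1 e3 b2 by algebra
  have b4: "b 4 * v 0 ^ 7 = 5 * v 0 * v 1 * v 2 - v 0 ^ 2 * v 3 - 5 * v 1 ^ 3"
    using e1 e4 b2 b3 by algebra
  have "(b 2 * b 4 - \<mu> * b 3 ^ 2) * v 0 ^ 10
      = (b 2 * v 0 ^ 3) * (b 4 * v 0 ^ 7) - \<mu> * (b 3 * v 0 ^ 5) ^ 2"
    by algebra
  also have "\<dots> = v 0 ^ 2 * (v 1 * v 3 - \<mu> * v 2 ^ 2)
     + (4 * \<mu> - 5) * (v 0 * v 1 ^ 2 * v 2 - v 1 ^ 4)"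
    unfolding b2 b3 b4 by algebra
  finally have "b 2 * b 4 - \<mu> * b 3 ^ 2 =
    (v 0 ^ 2 * (v 1 * v 3 - \<mu> * v 2 ^ 2)
     + (4 * \<mu> - 5) * (v 0 * v 1 ^ 2 * v 2 - v 1 ^ 4)) / v 0 ^ 10"
    using v0 by (simp add: eq_divide_eq)
  then show ?thesis by (simp add: v_def b_def)
qed

section \<open>The extremal estimate\<close>

text \<open>The weights are the binomial expansion of \<open>((1 - s) + s)\<^sup>2 = 1\<close>.\<close>

lemma convex_combination_bound:
  fixes s C D E :: real
  assumes "0 \<le> s" "s \<le> 1"
  shows "(1 - s)\<^sup>2 * C + 2 * s * (1 - s) * E + s\<^sup>2 * D \<le> Max {C, D, E}"
proof -
  let ?M = "Max {C, D, E}"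
  have "(1 - s)\<^sup>2 * C + 2 * s * (1 - s) * E + s\<^sup>2 * D
      \<le> (1 - s)\<^sup>2 * ?M + 2 * s * (1 - s) * ?M + s\<^sup>2 * ?M"
    using assms by (intro add_mono mult_left_mono) auto
  also have "\<dots> = ?M"
    by (simp add: algebra_simps power2_eq_square)
  finally show ?thesis .
qed

text \<open>The weight \<open>max 1 (norm \<mu>)\<close> dominates the coefficients of both products
  \<open>P\<^sub>0 P\<^sub>2\<close> and \<open>P\<^sub>1\<^sup>2\<close>, so \<open>schur_coeff_2_bound\<close> controls them together. The separate
  bounds \<open>\<bar>P\<^sub>2\<bar> \<le> 1 - \<bar>P\<^sub>0\<bar>\<^sup>2\<close> and \<open>\<bar>P\<^sub>1\<bar> \<le> 1 - \<bar>P\<^sub>0\<bar>\<^sup>2\<close> would give a sum that can exceed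
  \<open>1 - \<bar>P\<^sub>0\<bar>\<^sup>2\<close>.\<close>

lemma schur_coeff_functional_bound:
  assumes "schur_fps P" and "norm K \<le> k"
  shows "norm (fps_nth P 0 * fps_nth P 2 - \<mu> * fps_nth P 1 ^ 2
            + 2 * K * (fps_nth P 0 ^ 2 * fps_nth P 1) + L * fps_nth P 0 ^ 4)
         \<le> Max {max 1 (norm \<mu>), norm L, k + max 1 (norm \<mu>) / 2}"
proof -
  define p where "p = fps_nth P"
  define s C where "s = (norm (p 0))\<^sup>2" and "C = max 1 (norm \<mu>)"
  have s: "0 \<le> s" "s \<le> 1" and C: "1 \<le> C" "norm \<mu> \<le> C"
    using schur_fps_nth_0_le[OF assms(1)] by (auto simp: s_def C_def p_def abs_square_le_1)
  have "norm (p 0 * p 2 - \<mu> * p 1 ^ 2) \<le> norm (p 0) * norm (p 2) + norm \<mu> * (norm (p 1))\<^sup>2"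
    by (metis norm_mult norm_power norm_triangle_ineq4)
  also have "\<dots> \<le> C * (norm (p 0) * norm (p 2)) + C * (norm (p 1))\<^sup>2"
    using C mult_right_mono[of 1 C "norm (p 0) * norm (p 2)"]
    by (intro add_mono mult_right_mono) auto
  also have "\<dots> \<le> C * (1 - s)"
    using schur_coeff_2_bound[OF assms(1)] C
    by (simp add: p_def s_def flip: distrib_left)
  finally have 1: "norm (p 0 * p 2 - \<mu> * p 1 ^ 2) \<le> C * (1 - s)" .
  have "norm (2 * K * (p 0 ^ 2 * p 1)) = 2 * norm K * (s * norm (p 1))"
    by (simp add: norm_mult norm_power s_def)
  also have "\<dots> \<le> 2 * k * (s * (1 - s))"
    using assms(2) s schur_coeff_1_bound[OF assms(1)]
    by (intro mult_mono mult_left_mono) (auto simp: s_def p_def intro: order_trans[OF norm_ge_zero])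
  finally have 2: "norm (2 * K * (p 0 ^ 2 * p 1)) \<le> 2 * k * (s * (1 - s))" .
  have 3: "norm (L * p 0 ^ 4) = norm L * s\<^sup>2"
    by (simp add: norm_mult norm_power s_def flip: power_mult)
  have "norm (p 0 * p 2 - \<mu> * p 1 ^ 2 + 2 * K * (p 0 ^ 2 * p 1) + L * p 0 ^ 4)
     \<le> C * (1 - s) + 2 * k * (s * (1 - s)) + norm L * s\<^sup>2"
    using 1 2 3 by (intro norm_triangle_mono) auto
  \<comment> \<open>The term \<open>C * s * (1 - s)\<close> split off from \<open>C * (1 - s)\<close> joins the mixed term; this is the
    origin of the summand \<open>C / 2\<close>.\<close>
  also have "\<dots> = (1 - s)\<^sup>2 * C + 2 * s * (1 - s) * (k + C / 2) + s\<^sup>2 * norm L"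
    by (simp add: algebra_simps power2_eq_square)
  also have "\<dots> \<le> Max {C, norm L, k + C / 2}"
    by (rule convex_combination_bound[OF s])
  finally show ?thesis by (simp add: p_def C_def)
qed

section \<open>From the function classes to power series\<close>

text \<open>The Schwarz lemma turns the condition \<open>\<omega> 0 = 0\<close> into \<open>\<omega> z = z * \<phi> z\<close>; the series \<open>Q\<close> of
  \<open>\<phi>\<close> is then free of side conditions other than lying in the Schur class.\<close>

lemma class_A_Id_series:
  assumes "\<psi> holomorphic_on ball 0 1" and "F \<in> class_A_Id \<psi>"
  obtains Q where "schur_fps Q"
    "F has_fps_expansion fps_X * (fps_expansion \<psi> 0 oo (fps_X * Q))"
proof -
  obtain \<omega> where \<omega>: "\<omega> holomorphic_on ball 0 1" "\<omega> ` ball 0 1 \<subseteq> ball 0 1" "\<omega> 0 = 0"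
    and F: "\<And>z. z \<in> ball 0 1 \<Longrightarrow> F z = z * \<psi> (\<omega> z)"
    using assms(2) by (auto simp: class_A_Id_def)
  have "norm (\<omega> z) < 1" if "norm z < 1" for z
    using \<omega>(2) that by (auto simp: image_subset_iff)
  then obtain \<phi> where \<phi>: "\<phi> holomorphic_on ball 0 1" "\<And>z. norm z < 1 \<Longrightarrow> \<omega> z = z * \<phi> z"
    "\<And>z. norm z < 1 \<Longrightarrow> norm (\<phi> z) \<le> 1"
    using schwarz_divide[OF \<omega>(1,3)] by blast
  define Q where "Q = fps_expansion \<phi> 0"
  have Q: "\<phi> has_fps_expansion Q"
    unfolding Q_def by (rule has_fps_expansion_fps_expansion[OF _ _ \<phi>(1)]) auto
  have \<psi>: "\<psi> has_fps_expansion fps_expansion \<psi> 0"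
    by (rule has_fps_expansion_fps_expansion[OF _ _ assms(1)]) auto
  have series: "(\<lambda>z. z * (\<psi> \<circ> (\<lambda>z. z * \<phi> z)) z) has_fps_expansion
      fps_X * (fps_expansion \<psi> 0 oo (fps_X * Q))"
    by (intro fps_expansion_intros \<psi> Q) auto
  have "eventually (\<lambda>z. F z = z * (\<psi> \<circ> (\<lambda>z. z * \<phi> z)) z) (nhds 0)"
    by (rule eventually_nhds_in_open[of "ball 0 1", THEN eventually_mono]) (use F \<phi>(2) in auto)
  from has_fps_expansion_cong[OF this refl] series
  have "F has_fps_expansion fps_X * (fps_expansion \<psi> 0 oo (fps_X * Q))"
    by simp
  moreover have "schur_fps Q"
    using \<phi> Q by (auto simp: schur_fps_def)
  ultimately show thesis using that by blast
qed

lemma local_inverse_series: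
  assumes "local_inverse_at_0 F G" and "F has_fps_expansion A" and "fps_nth A 0 = 0"
  shows "fps_expansion G 0 oo A = fps_X"
proof -
  have "G has_fps_expansion fps_expansion G 0"
    using assms(1) by (intro analytic_at_imp_has_fps_expansion_0) (auto simp: local_inverse_at_0_def)
  then have series: "(G \<circ> F) has_fps_expansion (fps_expansion G 0 oo A)"
    using assms by (intro has_fps_expansion_compose)
  have "eventually (\<lambda>z. (G \<circ> F) z = z) (nhds 0)"
    using assms(1) by (simp add: local_inverse_at_0_def)
  from has_fps_expansion_cong[OF this refl] series
  have "(\<lambda>z. z) has_fps_expansion (fps_expansion G 0 oo A)"
    by (simp add: o_def)
  then show ?thesis
    using has_fps_expansion_fps_X by (rule fps_expansion_unique_complex)
qed

theorem theorem5p5: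
  fixes \<psi> F G :: "complex \<Rightarrow> complex" and \<beta> :: "nat \<Rightarrow> complex" and \<mu> :: complex and C D E :: real
  assumes "\<psi> holomorphic_on ball 0 1"
    and "\<And>z. z \<in> ball 0 1 \<Longrightarrow> (\<lambda>k. \<beta> k * z ^ k) sums \<psi> z"
    and "\<beta> 0 \<noteq> 0"
    and "\<beta> 1 \<noteq> 0"
    and "F \<in> class_A_Id \<psi>"
    and "G \<in> class_B_Id \<psi>"
    and "local_inverse_at_0 F G"
  defines "C \<equiv> max 1 (norm \<mu>)"
    and "D \<equiv> norm (Phi 1 \<psi> \<mu> / \<beta> 1 ^ 2 + (4 * \<mu> - 5) * (Phi1 0 \<psi> / \<beta> 0 ^ 2))"
    and "E \<equiv> 1 / 2 * norm (4 * \<mu> - 5) * norm (\<beta> 1 / \<beta> 0)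
              + norm (1 - \<mu>) * norm (\<beta> 2 / \<beta> 1) + C / 2"
  shows "norm (Phi 2 G \<mu>) \<le> norm (\<beta> 1 ^ 2 / \<beta> 0 ^ 8) * Max {C, D, E}"
proof -
  define L where "L = Phi 1 \<psi> \<mu> / \<beta> 1 ^ 2 + (4 * \<mu> - 5) * (Phi1 0 \<psi> / \<beta> 0 ^ 2)"
  define K where "K = (4 * \<mu> - 5) / 2 * (\<beta> 1 / \<beta> 0) + (1 - \<mu>) * (\<beta> 2 / \<beta> 1)"
  define k where "k = 1 / 2 * norm (4 * \<mu> - 5) * norm (\<beta> 1 / \<beta> 0)
              + norm (1 - \<mu>) * norm (\<beta> 2 / \<beta> 1)"
  have "\<psi> has_fps_expansion Abs_fps \<beta>"
    by (rule has_fps_expansionI, rule eventually_nhds_in_open[of "ball 0 1", THEN eventually_mono])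
       (use assms(2) in auto)
  then have \<beta>: "fps_expansion \<psi> 0 = Abs_fps \<beta>"
    by (rule fps_expansion_eqI)
  obtain Q where Q: "schur_fps Q" and "F has_fps_expansion fps_X * (fps_expansion \<psi> 0 oo (fps_X * Q))"
    using class_A_Id_series[OF assms(1,5)] by blast
  then have F: "F has_fps_expansion fps_X * (Abs_fps \<beta> oo (fps_X * Q))"
    by (simp only: \<beta>)
  define q where "q = fps_nth Q"
  define V where "V = Abs_fps \<beta> oo (fps_X * Q)"
  have V: "fps_nth V 0 = \<beta> 0" "fps_nth V 1 = \<beta> 1 * q 0"
    "fps_nth V 2 = \<beta> 1 * q 1 + \<beta> 2 * q 0 ^ 2"
    "fps_nth V 3 = \<beta> 1 * q 2 + 2 * \<beta> 2 * q 0 * q 1 + \<beta> 3 * q 0 ^ 3"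
    unfolding V_def compose_X_mult_nth q_def by simp_all
  have GF: "fps_expansion G 0 oo (fps_X * V) = fps_X"
    using local_inverse_series[OF assms(7) F] by (simp add: V_def)
  have L': "L = (\<beta> 1 * \<beta> 3 - \<mu> * \<beta> 2 ^ 2) / \<beta> 1 ^ 2
      + (4 * \<mu> - 5) * ((\<beta> 0 * \<beta> 2 - \<beta> 1 ^ 2) / \<beta> 0 ^ 2)"
    by (simp add: L_def Phi_def \<beta> numeral_eq_Suc)
  have "Phi 2 G \<mu> = fps_nth (fps_expansion G 0) 2 * fps_nth (fps_expansion G 0) 4
      - \<mu> * fps_nth (fps_expansion G 0) 3 ^ 2"
    by (simp add: Phi_def)
  also have "\<dots> = (\<beta> 0 ^ 2 * (\<beta> 1 * q 0 * (\<beta> 1 * q 2 + 2 * \<beta> 2 * q 0 * q 1 + \<beta> 3 * q 0 ^ 3)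
        - \<mu> * (\<beta> 1 * q 1 + \<beta> 2 * q 0 ^ 2) ^ 2)
      + (4 * \<mu> - 5) * (\<beta> 0 * (\<beta> 1 * q 0) ^ 2 * (\<beta> 1 * q 1 + \<beta> 2 * q 0 ^ 2) - (\<beta> 1 * q 0) ^ 4))
      / \<beta> 0 ^ 10" (is "_ = ?num / _")
    using inverse_series_phi_2[OF GF, of \<mu>] assms(3) unfolding V by blast
  also have "\<dots> = \<beta> 1 ^ 2 / \<beta> 0 ^ 8 *
      (q 0 * q 2 - \<mu> * q 1 ^ 2 + 2 * K * (q 0 ^ 2 * q 1) + L * q 0 ^ 4)"
    (is "_ = _ * ?Y")
  proof -
    \<comment> \<open>Both constants are cleared of denominators, so that the remaining identity is polynomial.\<close>
    have K': "2 * K * (\<beta> 0 * \<beta> 1) = (4 * \<mu> - 5) * \<beta> 1 ^ 2 + 2 * (1 - \<mu>) * (\<beta> 0 * \<beta> 2)"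
      unfolding K_def using assms(3,4) by (simp add: field_simps power2_eq_square)
    have L'': "L * (\<beta> 0 ^ 2 * \<beta> 1 ^ 2) = (\<beta> 1 * \<beta> 3 - \<mu> * \<beta> 2 ^ 2) * \<beta> 0 ^ 2
        + (4 * \<mu> - 5) * (\<beta> 0 * \<beta> 2 - \<beta> 1 ^ 2) * \<beta> 1 ^ 2"
      unfolding L' distrib_right using assms(3,4) by simp
    have num: "?num = \<beta> 0 ^ 2 * \<beta> 1 ^ 2 * ?Y"
      using K' L'' by algebra
    have ten: "\<beta> 0 ^ 10 = \<beta> 0 ^ 2 * \<beta> 0 ^ 8"
      by (simp flip: power_add)
    have cancel: "a * x * y / (a * e) = x / e * y" if "a \<noteq> 0" for a x y e :: complex
      using that by simp
    show ?thesis
      unfolding num ten by (rule cancel) (use assms(3) in simp)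
  qed
  finally have Phi: "Phi 2 G \<mu> = \<dots>" .
  have "norm K \<le> k"
    unfolding K_def k_def
    by (intro norm_triangle_ineq[THEN order_trans] add_mono) (auto simp: norm_mult norm_divide)
  from schur_coeff_functional_bound[OF Q this, of \<mu> L]
  have "norm (q 0 * q 2 - \<mu> * q 1 ^ 2 + 2 * K * (q 0 ^ 2 * q 1) + L * q 0 ^ 4) \<le> Max {C, D, E}"
    by (simp only: q_def C_def D_def E_def L_def k_def)
  then show ?thesis
    unfolding Phi norm_mult[of "\<beta> 1 ^ 2 / \<beta> 0 ^ 8"] by (rule mult_left_mono) simp
qed

end
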